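(* In the setting below, the function $f_{\rm plr}\colon 2^R\to\mathbb{R}_+$ defined by \[ f_{\rm plr}(X)=\min\Bigl\{\tfrac{1}{2},\ 1-\sum_{\psi \in \Psi_{X\cap H}}p(\psi\mid \phi)\Bigr\} \] for $X\subseteq R$ is monotone, submodular, and proper (i.e., $f_{\rm plr}(\emptyset)=0$).
   Context: Let $G=(V,E)$ be an undirected graph with a root node $r\in V$. For $v\in V$, $N[v]$ denotes $v$ together with its neighbors; $G[X]$ is the subgraph induced by $X\subseteq V$. A full realization is a vector $\psi\in\{0,1\}^V$ with $\psi(r)=1$ ($\psi(v)=1$ means $v$ is active); $\Psi$ is the set of full realizations, and $p$ is a probability distribution on $\Psi$. Let $A_\psi=\{v:\psi(v)=1\}$. A realization is a vector $\phi\in\{0,1,*\}^V$, with ${\rm supp}(\phi)=\{v:\phi(v)\ne *\}$; $\psi\succeq\phi$ means $\psi(v)=\phi(v)$ for all $v\in{\rm supp}(\phi)$. For $\psi\succeq\phi$, $p(\psi\mid\phi)=p(\psi)/\sum_{\psi'\in\Psi:\psi'\succeq\phi}p(\psi')$. Fix a realization $\phi$ with $\phi(r)=1$ and $\sum_{\psi\succeq\phi}p(\psi)>0$, and a set $U\subseteq{\rm supp}(\phi)$ with $r\in U$. Let $\Psi_\phi=\{\psi\in\Psi:\psi\succeq\phi,\ p(\psi)>0\}$, let $H=\{v\in V\setminus U:\sum_{\psi\in\Psi_\phi:\,v\in A_\psi}p(\psi\mid\phi)>1/2\}$, and let $R$ be the node set of the connected component of $G[U\cup H]$ containing $r$. For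 $v\in R\cap H$ define $\xi_v\in\{0,1,*\}^V$ by $\xi_v(u)=*$ for $u\notin N[v]$, $\xi_v(u)=1$ for $u\in H\cap N[v]$, and $\xi_v(u)=0$ for $u\in N[v]\setminus H$. For $H'\subseteq R\cap H$, let $\Psi_{H'}=\{\psi\in\Psi_\phi:\psi\succeq\xi_v \text{ for all } v\in H'\}$. *)

theory Defs
  imports
    "Graph_Theory.Digraph_Component"
    "HOL-Probability.Probability_Mass_Function"
    "HOL-Library.FuncSet"
begin

(* Undirected graphs are the symmetric digraphs of Graph_Theory. *)

definition closed_nbhd :: "('a, 'b) pre_digraph \<Rightarrow> 'a \<Rightarrow> 'a set" where
  "closed_nbhd G v = insert v {u. (v, u) \<in> arcs_ends G}"

(* Vectors in {0,1}^V are extensional functions V -> bool (True for 1, False for 0). Vectors in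
   {0,1,star}^V are maps with domain contained in V (None for star), so the support of such a
   vector is its domain. *)

definition full_realizations :: "('a, 'b) pre_digraph \<Rightarrow> 'a \<Rightarrow> ('a \<Rightarrow> bool) set" where
  "full_realizations G r = {\<psi> \<in> verts G \<rightarrow>\<^sub>E (UNIV :: bool set). \<psi> r = True}"

definition active :: "('a, 'b) pre_digraph \<Rightarrow> ('a \<Rightarrow> bool) \<Rightarrow> 'a set" where
  "active G \<psi> = {v \<in> verts G. \<psi> v = True}"

definition consistent :: "('a \<Rightarrow> bool) \<Rightarrow> ('a \<rightharpoonup> bool) \<Rightarrow> bool"  (infix "\<succeq>\<^sub>r" 50) where
  "\<psi> \<succeq>\<^sub>r \<phi> \<longleftrightarrow> (\<forall>v \<in> dom \<phi>. \<phi> v = Some (\<psi> v))"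

definition realization_prob ::
  "('a, 'b) pre_digraph \<Rightarrow> 'a \<Rightarrow> ('a \<Rightarrow> bool) pmf \<Rightarrow> ('a \<rightharpoonup> bool) \<Rightarrow> real" where
  "realization_prob G r p \<phi> = (\<Sum>\<psi> \<in> {\<psi> \<in> full_realizations G r. \<psi> \<succeq>\<^sub>r \<phi>}. pmf p \<psi>)"

definition cond_real_prob ::
  "('a, 'b) pre_digraph \<Rightarrow> 'a \<Rightarrow> ('a \<Rightarrow> bool) pmf \<Rightarrow> ('a \<Rightarrow> bool) \<Rightarrow> ('a \<rightharpoonup> bool) \<Rightarrow> real" where
  "cond_real_prob G r p \<psi> \<phi> = pmf p \<psi> / realization_prob G r p \<phi>"

definition Psi_of ::
  "('a, 'b) pre_digraph \<Rightarrow> 'a \<Rightarrow> ('a \<Rightarrow> bool) pmf \<Rightarrow> ('a \<rightharpoonup> bool) \<Rightarrow> ('a \<Rightarrow> bool) set" where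
  "Psi_of G r p \<phi> = {\<psi> \<in> full_realizations G r. \<psi> \<succeq>\<^sub>r \<phi> \<and> pmf p \<psi> > 0}"

definition likely_nodes ::
  "('a, 'b) pre_digraph \<Rightarrow> 'a \<Rightarrow> ('a \<Rightarrow> bool) pmf \<Rightarrow> ('a \<rightharpoonup> bool) \<Rightarrow> 'a set \<Rightarrow> 'a set" where
  "likely_nodes G r p \<phi> U = {v \<in> verts G - U.
     (\<Sum>\<psi> \<in> {\<psi> \<in> Psi_of G r p \<phi>. v \<in> active G \<psi>}. cond_real_prob G r p \<psi> \<phi>) > 1 / 2}"

(* In a symmetric digraph the strongly connected component of r is the connected component of r
   in the underlying undirected graph. *)

definition root_component ::
  "('a, 'b) pre_digraph \<Rightarrow> 'a \<Rightarrow> ('a \<Rightarrow> bool) pmf \<Rightarrow> ('a \<rightharpoonup> bool) \<Rightarrow> 'a set \<Rightarrow> 'a set" where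
  "root_component G r p \<phi> U = pre_digraph.scc_of (G \<restriction> (U \<union> likely_nodes G r p \<phi> U)) r"

definition xi :: "('a, 'b) pre_digraph \<Rightarrow> 'a set \<Rightarrow> 'a \<Rightarrow> ('a \<rightharpoonup> bool)" where
  "xi G H v = (\<lambda>u. if u \<notin> closed_nbhd G v then None
                   else if u \<in> H then Some True else Some False)"

definition Psi_sub ::
  "('a, 'b) pre_digraph \<Rightarrow> 'a \<Rightarrow> ('a \<Rightarrow> bool) pmf \<Rightarrow> ('a \<rightharpoonup> bool) \<Rightarrow> 'a set \<Rightarrow> 'a set
    \<Rightarrow> ('a \<Rightarrow> bool) set" where
  "Psi_sub G r p \<phi> U H' =
     {\<psi> \<in> Psi_of G r p \<phi>. \<forall>v \<in> H'. \<psi> \<succeq>\<^sub>r xi G (likely_nodes G r p \<phi> U) v}"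

definition f_plr ::
  "('a, 'b) pre_digraph \<Rightarrow> 'a \<Rightarrow> ('a \<Rightarrow> bool) pmf \<Rightarrow> ('a \<rightharpoonup> bool) \<Rightarrow> 'a set \<Rightarrow> 'a set \<Rightarrow> real" where
  "f_plr G r p \<phi> U X =
     min (1 / 2)
       (1 - (\<Sum>\<psi> \<in> Psi_sub G r p \<phi> U (X \<inter> likely_nodes G r p \<phi> U). cond_real_prob G r p \<psi> \<phi>))"

definition submodular_on :: "'a set \<Rightarrow> ('a set \<Rightarrow> real) \<Rightarrow> bool" where
  "submodular_on R f \<longleftrightarrow>
     (\<forall>X \<in> Pow R. \<forall>Y \<in> Pow R. f X + f Y \<ge> f (X \<union> Y) + f (X \<inter> Y))"

definition proper_setfun :: "('a set \<Rightarrow> real) \<Rightarrow> bool" where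
  "proper_setfun f \<longleftrightarrow> f {} = 0"

end

theory Submission
  imports Defs
begin

text \<open>Given \<open>\<phi>\<close>, let \<open>m\<close> be the conditional probability measure. The sets \<open>\<Psi>\<^sub>X\<close> turn unions into
  intersections and \<open>\<Psi>\<^sub>X \<union> \<Psi>\<^sub>Y \<subseteq> \<Psi>\<^bsub>X \<inter> Y\<^esub>\<close>, so modularity of \<open>m\<close> makes \<open>X \<mapsto> 1 - m \<Psi>\<^sub>X\<close> monotone and
  submodular. Both properties survive truncation at a constant.\<close>

lemma mono_on_min_const:
  fixes f :: "'a set \<Rightarrow> real"
  assumes "mono_on A f"
  shows "mono_on A (\<lambda>X. min c (f X))"
  using assms by (fastforce simp: mono_on_def)

text \<open>If \<open>f X\<close> and \<open>f Y\<close> both lie below \<open>c\<close>, the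
  right-hand side is not truncated and submodularity of \<open>f\<close> suffices. If one of them
  reaches \<open>c\<close>, it dominates the truncated value at the union, and monotonicity bounds
  the value at the intersection by the other one.\<close>

lemma submodular_on_min_const:
  assumes mono: "mono_on (Pow R) f" and sub: "submodular_on R f"
  shows "submodular_on R (\<lambda>X. min c (f X))"
  unfolding submodular_on_def
proof (intro ballI)
  fix X Y assume XY: "X \<in> Pow R" "Y \<in> Pow R"
  have "f (X \<inter> Y) \<le> f X" "f (X \<inter> Y) \<le> f Y" "f X \<le> f (X \<union> Y)" "f Y \<le> f (X \<union> Y)"
    using XY by (auto intro!: mono_onD[OF mono])
  moreover have "f (X \<union> Y) + f (X \<inter> Y) \<le> f X + f Y"
    using sub XY by (auto simp: submodular_on_def)
  ultimately show "min c (f (X \<union> Y)) + min c (f (X \<inter> Y)) \<le> min c (f X) + min c (f Y)"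
    by (auto simp: min_def)
qed

text \<open>A \<open>sum\<close> over an infinite set defaults to 0, so finiteness is what makes the
  sums below genuine probabilities.\<close>

lemma finite_full_realizations:
  assumes "finite (verts G)"
  shows "finite (full_realizations G r)"
  unfolding full_realizations_def
  using finite_PiE[OF assms, of "\<lambda>_. UNIV :: bool set"] by (auto intro: finite_subset[rotated])

lemma finite_Psi_of:
  assumes "finite (verts G)"
  shows "finite (Psi_of G r p \<phi>)"
  using finite_full_realizations[OF assms] by (rule finite_subset[rotated]) (auto simp: Psi_of_def)

lemma finite_Psi_sub:
  assumes "finite (verts G)"
  shows "finite (Psi_sub G r p \<phi> U X)"
  using finite_Psi_of[OF assms] by (rule finite_subset[rotated]) (auto simp: Psi_sub_def)

lemma cond_real_prob_nonneg: "0 \<le> cond_real_prob G r p \<psi> \<phi>"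
  by (simp add: cond_real_prob_def realization_prob_def sum_nonneg)

text \<open>The realizations consistent with \<open>\<phi>\<close> that \<open>Psi_of\<close> leaves
  out have weight 0, so the numerators already add up to the normalizing constant, which is nonzero
  by assumption.\<close>

lemma sum_cond_real_prob_Psi_of:
  assumes "finite (verts G)" and "realization_prob G r p \<phi> > 0"
  shows "(\<Sum>\<psi>\<in>Psi_of G r p \<phi>. cond_real_prob G r p \<psi> \<phi>) = 1"
proof -
  have "(\<Sum>\<psi>\<in>Psi_of G r p \<phi>. pmf p \<psi>) = realization_prob G r p \<phi>"
    unfolding realization_prob_def using finite_full_realizations[OF assms(1)]
    by (intro sum.mono_neutral_left) (auto simp: Psi_of_def order_less_le)
  then show ?thesis
    using assms(2) by (simp add: cond_real_prob_def flip: sum_divide_distrib)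
qed

lemma Psi_sub_empty: "Psi_sub G r p \<phi> U {} = Psi_of G r p \<phi>"
  by (simp add: Psi_sub_def)

lemma Psi_sub_Un: "Psi_sub G r p \<phi> U (X \<union> Y) = Psi_sub G r p \<phi> U X \<inter> Psi_sub G r p \<phi> U Y"
  by (auto simp: Psi_sub_def)

lemma Psi_sub_antimono: "X \<subseteq> Y \<Longrightarrow> Psi_sub G r p \<phi> U Y \<subseteq> Psi_sub G r p \<phi> U X"
  by (auto simp: Psi_sub_def)

text \<open>When \<open>G\<close> is finite and \<open>\<phi>\<close> has positive probability, this
  is the conditional probability that some likely node in \<open>X\<close> has a closed neighborhood
  deviating from its prediction \<open>xi\<close>.\<close>

definition miss_prob ::
  "('a, 'b) pre_digraph \<Rightarrow> 'a \<Rightarrow> ('a \<Rightarrow> bool) pmf \<Rightarrow> ('a \<rightharpoonup> bool) \<Rightarrow> 'a set \<Rightarrow> 'a set \<Rightarrow> real" where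
  "miss_prob G r p \<phi> U X =
     1 - (\<Sum>\<psi> \<in> Psi_sub G r p \<phi> U (X \<inter> likely_nodes G r p \<phi> U). cond_real_prob G r p \<psi> \<phi>)"

lemma f_plr_eq_min_miss_prob: "f_plr G r p \<phi> U = (\<lambda>X. min (1 / 2) (miss_prob G r p \<phi> U X))"
  by (simp add: fun_eq_iff f_plr_def miss_prob_def)

lemma miss_prob_mono:
  assumes "finite (verts G)" and "X \<subseteq> Y"
  shows "miss_prob G r p \<phi> U X \<le> miss_prob G r p \<phi> U Y"
  unfolding miss_prob_def
  using assms by (intro diff_left_mono sum_mono2 finite_Psi_sub Psi_sub_antimono
      cond_real_prob_nonneg) auto

lemma miss_prob_empty:
  assumes "finite (verts G)" and "realization_prob G r p \<phi> > 0"
  shows "miss_prob G r p \<phi> U {} = 0"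
  by (simp add: miss_prob_def Psi_sub_empty sum_cond_real_prob_Psi_of[OF assms])

lemma miss_prob_nonneg:
  assumes "finite (verts G)" and "realization_prob G r p \<phi> > 0"
  shows "0 \<le> miss_prob G r p \<phi> U X"
  using miss_prob_mono[OF assms(1) empty_subsetI] miss_prob_empty[OF assms] by metis

lemma submodular_on_miss_prob:
  assumes fin: "finite (verts G)"
  shows "submodular_on R (miss_prob G r p \<phi> U)"
  unfolding submodular_on_def
proof (intro ballI)
  fix X Y
  define H where "H = likely_nodes G r p \<phi> U"
  define P where "P Z = Psi_sub G r p \<phi> U (Z \<inter> H)" for Z
  define m where "m = sum (\<lambda>\<psi>. cond_real_prob G r p \<psi> \<phi>)"
  have finP: "finite (P Z)" for Z
    unfolding P_def by (rule finite_Psi_sub[OF fin])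
  have "P (X \<union> Y) = P X \<inter> P Y"
    by (simp add: P_def Int_Un_distrib2 Psi_sub_Un)
  moreover have "m (P X \<union> P Y) + m (P X \<inter> P Y) = m (P X) + m (P Y)"
    unfolding m_def by (rule sum.union_inter[OF finP finP])
  \<comment> \<open>The only source of inequality: a realization may meet every prediction on the
    intersection and still violate one at a node only in \<open>X\<close> and one at a node only in
    \<open>Y\<close>.\<close>
  moreover have "P X \<union> P Y \<subseteq> P (X \<inter> Y)"
    unfolding P_def by (intro Un_least Psi_sub_antimono) auto
  then have "m (P X \<union> P Y) \<le> m (P (X \<inter> Y))"
    unfolding m_def by (intro sum_mono2 finP cond_real_prob_nonneg)
  moreover have "miss_prob G r p \<phi> U Z = 1 - m (P Z)" for Z
    by (simp add: miss_prob_def m_def P_def H_def)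
  ultimately show "miss_prob G r p \<phi> U (X \<union> Y) + miss_prob G r p \<phi> U (X \<inter> Y)
      \<le> miss_prob G r p \<phi> U X + miss_prob G r p \<phi> U Y"
    by simp
qed

theorem theorem3:
  fixes G :: "('a, 'b) pre_digraph" and r :: 'a
    and p :: "('a \<Rightarrow> bool) pmf" and \<phi> :: "'a \<rightharpoonup> bool" and U :: "'a set"
  assumes "pseudo_graph G" and "r \<in> verts G"
    and "set_pmf p \<subseteq> full_realizations G r"
    and "dom \<phi> \<subseteq> verts G" and "\<phi> r = Some True"
    and "realization_prob G r p \<phi> > 0"
    and "U \<subseteq> dom \<phi>" and "r \<in> U"
  shows "f_plr G r p \<phi> U \<in> Pow (root_component G r p \<phi> U) \<rightarrow> {0..}
       \<and> mono_on (Pow (root_component G r p \<phi> U)) (f_plr G r p \<phi> U)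
       \<and> submodular_on (root_component G r p \<phi> U) (f_plr G r p \<phi> U)
       \<and> proper_setfun (f_plr G r p \<phi> U)"
proof -
  interpret pseudo_graph G by fact
  have mono: "mono_on A (miss_prob G r p \<phi> U)" for A
    by (rule mono_onI) (rule miss_prob_mono[OF finite_verts])
  show ?thesis
    unfolding f_plr_eq_min_miss_prob proper_setfun_def
    \<comment> \<open>Since 1/2 is nonnegative, truncation preserves both nonnegativity and the
      value 0 at the empty set.\<close>
    using miss_prob_nonneg[OF finite_verts assms(6)] miss_prob_empty[OF finite_verts assms(6)]
    by (auto intro: mono_on_min_const mono
        submodular_on_min_const[OF mono submodular_on_miss_prob[OF finite_verts]])
qed

end
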